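(* Let $F\colon\mathscr E\to\mathscr B$ be a Grothendieck fibration and let $B$ be a base of computability in $\mathscr B$. Then $F^{-1}(B)$, defined for every object $e$ of $\mathscr E$ by $$F^{-1}(B)(e)=\{\,i\in\mathrm{Mon}(-,e)\mid i\text{ is a cartesian lift of some }j\in B(F(e))\,\},$$ is a base of computability in $\mathscr E$.
   Context: A base of computability $B$ in a category $\mathscr C$ is a family $(B(a))_{a\in\mathscr C_0}$, where each $B(a)$ is a subclass of the class $\mathrm{Mon}(-,a)$ of monomorphisms with codomain $a$, such that: (Base1) $1_a\in B(a)$ for every object $a$; (Base2) for all objects $a,b$, all $i\colon s\to a$ in $B(a)$, all $j\colon t\to b$ in $B(b)$, and all $f\colon s\to b$, there is a pullback of $j$ along $f$, with projection $f^*j\colon j^*(s)\to s$, such that $i\circ f^*j\in B(a)$. An arrow $i\colon e'\to e$ of $\mathscr E$ is a cartesian lift of $j\colon b'\to F(e)$ if $F(i)=j$ and for every $g\colon d\to e$ in $\mathscr E$ and $h\colon F(d)\to b'$ with $j\circ h=F(g)$ there is a unique $k\colon d\to e'$ with $F(k)=h$ and $i\circ k=g$. *)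

theory Defs
  imports Main
begin

text \<open>
  Categories have carriers of objects and of arrows, in the style of HOL-Algebra; both may be
  arbitrary, possibly infinite, sets. The composite \<open>g \<cdot> f\<close> is ``\<open>g\<close> after \<open>f\<close>'' and
  carries meaning only for \<open>Dom g = Cod f\<close>.
\<close>

record ('o, 'm) category =
  Obj :: "'o set"
  Arr :: "'m set"
  Dom :: "'m \<Rightarrow> 'o"
  Cod :: "'m \<Rightarrow> 'o"
  Id :: "'o \<Rightarrow> 'm"
  Comp :: "'m \<Rightarrow> 'm \<Rightarrow> 'm" (infixl "\<cdot>\<index>" 70)

definition Hom :: "('o, 'm, 'z) category_scheme \<Rightarrow> 'o \<Rightarrow> 'o \<Rightarrow> 'm set" where
  "Hom C a b = {f \<in> Arr C. Dom C f = a \<and> Cod C f = b}"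

locale category =
  fixes C :: "('o, 'm, 'z) category_scheme" (structure)
  assumes Dom_Obj: "f \<in> Arr C \<Longrightarrow> Dom C f \<in> Obj C"
    and Cod_Obj: "f \<in> Arr C \<Longrightarrow> Cod C f \<in> Obj C"
    and Id_Hom: "a \<in> Obj C \<Longrightarrow> Id C a \<in> Hom C a a"
    and Comp_Hom: "\<lbrakk>f \<in> Hom C a b; g \<in> Hom C b c\<rbrakk> \<Longrightarrow> g \<cdot> f \<in> Hom C a c"
    and Comp_Id_right: "f \<in> Hom C a b \<Longrightarrow> f \<cdot> Id C a = f"
    and Comp_Id_left: "f \<in> Hom C a b \<Longrightarrow> Id C b \<cdot> f = f"
    and Comp_assoc: "\<lbrakk>f \<in> Hom C a b; g \<in> Hom C b c; h \<in> Hom C c d\<rbrakk>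
      \<Longrightarrow> (h \<cdot> g) \<cdot> f = h \<cdot> (g \<cdot> f)"

record ('o1, 'm1, 'o2, 'm2) functor_maps =
  on_Obj :: "'o1 \<Rightarrow> 'o2"
  on_Arr :: "'m1 \<Rightarrow> 'm2"

locale category_functor = dom: category \<E> + cod: category \<B>
  for \<E> :: "('o1, 'm1, 'z1) category_scheme" and \<B> :: "('o2, 'm2, 'z2) category_scheme" +
  fixes F :: "('o1, 'm1, 'o2, 'm2) functor_maps"
  assumes on_Obj: "a \<in> Obj \<E> \<Longrightarrow> on_Obj F a \<in> Obj \<B>"
    and on_Arr: "f \<in> Hom \<E> a b \<Longrightarrow> on_Arr F f \<in> Hom \<B> (on_Obj F a) (on_Obj F b)"
    and on_Id: "a \<in> Obj \<E> \<Longrightarrow> on_Arr F (Id \<E> a) = Id \<B> (on_Obj F a)"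
    and on_Comp: "\<lbrakk>f \<in> Hom \<E> a b; g \<in> Hom \<E> b c\<rbrakk>
      \<Longrightarrow> on_Arr F (g \<cdot>\<^bsub>\<E>\<^esub> f) = on_Arr F g \<cdot>\<^bsub>\<B>\<^esub> on_Arr F f"

definition mono_arrow :: "('o, 'm, 'z) category_scheme \<Rightarrow> 'm \<Rightarrow> bool" where
  "mono_arrow C i \<longleftrightarrow> i \<in> Arr C \<and>
    (\<forall>d. \<forall>g\<in>Hom C d (Dom C i). \<forall>h\<in>Hom C d (Dom C i). i \<cdot>\<^bsub>C\<^esub> g = i \<cdot>\<^bsub>C\<^esub> h \<longrightarrow> g = h)"

definition Mon :: "('o, 'm, 'z) category_scheme \<Rightarrow> 'o \<Rightarrow> 'm set" where
  "Mon C a = {i. mono_arrow C i \<and> Cod C i = a}"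

text \<open>
  For a cospan of \<open>f : s \<rightarrow> b\<close> and \<open>j : t \<rightarrow> b\<close>, the span of \<open>p : q \<rightarrow> s\<close> and \<open>r : q \<rightarrow> t\<close> is
  a pullback; \<open>p\<close> is the projection that is the pullback of \<open>j\<close> along \<open>f\<close>.
\<close>

definition is_pullback :: "('o, 'm, 'z) category_scheme \<Rightarrow> 'm \<Rightarrow> 'm \<Rightarrow> 'm \<Rightarrow> 'm \<Rightarrow> bool" where
  "is_pullback C f j p r \<longleftrightarrow>
    f \<in> Arr C \<and> j \<in> Arr C \<and> Cod C f = Cod C j \<and>
    (\<exists>q. p \<in> Hom C q (Dom C f) \<and> r \<in> Hom C q (Dom C j) \<and>
      f \<cdot>\<^bsub>C\<^esub> p = j \<cdot>\<^bsub>C\<^esub> r \<and>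
      (\<forall>d. \<forall>u\<in>Hom C d (Dom C f). \<forall>v\<in>Hom C d (Dom C j). f \<cdot>\<^bsub>C\<^esub> u = j \<cdot>\<^bsub>C\<^esub> v \<longrightarrow>
        (\<exists>!k. k \<in> Hom C d q \<and> p \<cdot>\<^bsub>C\<^esub> k = u \<and> r \<cdot>\<^bsub>C\<^esub> k = v)))"

definition base_of_computability ::
  "('o, 'm, 'z) category_scheme \<Rightarrow> ('o \<Rightarrow> 'm set) \<Rightarrow> bool" where
  "base_of_computability C B \<longleftrightarrow>
    (\<forall>a\<in>Obj C. B a \<subseteq> Mon C a) \<and>
    (\<forall>a\<in>Obj C. Id C a \<in> B a) \<and>
    (\<forall>a\<in>Obj C. \<forall>b\<in>Obj C. \<forall>i\<in>B a. \<forall>j\<in>B b. \<forall>f\<in>Hom C (Dom C i) b.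
      \<exists>p r. is_pullback C f j p r \<and> i \<cdot>\<^bsub>C\<^esub> p \<in> B a)"

definition cartesian_lift :: "('o1, 'm1, 'z1) category_scheme \<Rightarrow> ('o2, 'm2, 'z2) category_scheme
    \<Rightarrow> ('o1, 'm1, 'o2, 'm2) functor_maps \<Rightarrow> 'm1 \<Rightarrow> 'm2 \<Rightarrow> bool" where
  "cartesian_lift \<E> \<B> F i j \<longleftrightarrow>
    i \<in> Arr \<E> \<and> on_Arr F i = j \<and>
    (\<forall>d\<in>Obj \<E>. \<forall>g\<in>Hom \<E> d (Cod \<E> i). \<forall>h\<in>Hom \<B> (on_Obj F d) (Dom \<B> j).
      j \<cdot>\<^bsub>\<B>\<^esub> h = on_Arr F g \<longrightarrow>
      (\<exists>!k. k \<in> Hom \<E> d (Dom \<E> i) \<and> on_Arr F k = h \<and> i \<cdot>\<^bsub>\<E>\<^esub> k = g))"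

text \<open>No choice of cartesian lifts (cleavage) is part of the structure.\<close>

locale grothendieck_fibration = category_functor +
  assumes ex_cartesian_lift: "\<lbrakk>e \<in> Obj \<E>; j \<in> Hom \<B> b' (on_Obj F e)\<rbrakk>
    \<Longrightarrow> \<exists>i. Cod \<E> i = e \<and> cartesian_lift \<E> \<B> F i j"

definition inverse_image_base ::
  "('o1, 'm1, 'z1) category_scheme \<Rightarrow> ('o2, 'm2, 'z2) category_scheme
    \<Rightarrow> ('o1, 'm1, 'o2, 'm2) functor_maps \<Rightarrow> ('o2 \<Rightarrow> 'm2 set) \<Rightarrow> 'o1 \<Rightarrow> 'm1 set" where
  "inverse_image_base \<E> \<B> F B e =
    {i \<in> Mon \<E> e. \<exists>j\<in>B (on_Obj F e). cartesian_lift \<E> \<B> F i j}"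

end

theory Submission
  imports Defs
begin

text \<open>
  Identities are cartesian monomorphisms, which gives the first closure condition. The second one
  rests on the fact that a fibration lifts pullbacks: let \<open>j : t \<rightarrow> b\<close> be cartesian, let
  \<open>f : s \<rightarrow> b\<close> be any arrow, and suppose that the base has a pullback of \<open>F j\<close> along \<open>F f\<close> with
  projections \<open>p\<^sub>0\<close> and \<open>r\<^sub>0\<close>. Choose a cartesian lift \<open>p\<close> of \<open>p\<^sub>0\<close> with codomain \<open>s\<close>. As \<open>j\<close> is
  cartesian and \<open>F (f \<cdot> p) = F j \<cdot> r\<^sub>0\<close>, some \<open>r\<close> over \<open>r\<^sub>0\<close> completes the square, and the square is a
  pullback: a cone in \<open>\<E>\<close> has a unique comparison arrow in the base, which lifts uniquely along
  \<open>p\<close> (\<open>pullback_cartesian_lift\<close>).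

  For a cartesian monomorphism \<open>i\<close> over an element of \<open>B\<close>, the composite \<open>i \<cdot> p\<close> is then
  cartesian over \<open>F i \<cdot> p\<^sub>0\<close>, because cartesian arrows compose, and it is monic, because pullbacks
  of monomorphisms are monic and monomorphisms compose. The second closure condition for \<open>B\<close>
  supplies \<open>p\<^sub>0\<close> together with the membership of \<open>F i \<cdot> p\<^sub>0\<close> in \<open>B\<close>.
\<close>

section \<open>Monomorphisms and pullbacks\<close>

lemma Hom_Arr: "f \<in> Hom C a b \<Longrightarrow> f \<in> Arr C"
  and Hom_Dom: "f \<in> Hom C a b \<Longrightarrow> Dom C f = a"
  and Hom_Cod: "f \<in> Hom C a b \<Longrightarrow> Cod C f = b"
  by (auto simp: Hom_def)

lemma mono_arrowD:
  "\<lbrakk>mono_arrow C i; g \<in> Hom C d (Dom C i); h \<in> Hom C d (Dom C i); i \<cdot>\<^bsub>C\<^esub> g = i \<cdot>\<^bsub>C\<^esub> h\<rbrakk> \<Longrightarrow> g = h"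
  unfolding mono_arrow_def by blast

text \<open>
  Once the domain of \<open>p\<close> is known, the apex that \<open>is_pullback_def\<close> quantifies existentially is
  determined, so the universal property can be read and established for that apex.
\<close>

lemma is_pullback_iff:
  assumes f: "f \<in> Hom C s b" and j: "j \<in> Hom C t b" and p: "p \<in> Hom C q s"
  shows "is_pullback C f j p r \<longleftrightarrow> r \<in> Hom C q t \<and> f \<cdot>\<^bsub>C\<^esub> p = j \<cdot>\<^bsub>C\<^esub> r \<and>
    (\<forall>d. \<forall>u\<in>Hom C d s. \<forall>v\<in>Hom C d t. f \<cdot>\<^bsub>C\<^esub> u = j \<cdot>\<^bsub>C\<^esub> v \<longrightarrow>
      (\<exists>!k. k \<in> Hom C d q \<and> p \<cdot>\<^bsub>C\<^esub> k = u \<and> r \<cdot>\<^bsub>C\<^esub> k = v))"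
proof -
  have "p \<in> Hom C x s \<longleftrightarrow> x = q" for x using p by (auto simp: Hom_def)
  then show ?thesis
    unfolding is_pullback_def Hom_Dom[OF f] Hom_Dom[OF j] Hom_Cod[OF f] Hom_Cod[OF j]
    using Hom_Arr[OF f] Hom_Arr[OF j] by simp
qed

context category
begin

lemma Hom_Obj: "f \<in> Hom C a b \<Longrightarrow> a \<in> Obj C \<and> b \<in> Obj C"
  using Dom_Obj Cod_Obj by (auto simp: Hom_def)

lemma mono_arrow_Id:
  assumes "a \<in> Obj C"
  shows "mono_arrow C (Id C a)"
  unfolding mono_arrow_def
  using Id_Hom[OF assms] by (auto simp: Hom_Dom Hom_Arr Comp_Id_left)

lemma mono_arrow_Comp:
  assumes p: "p \<in> Hom C a b" and i: "i \<in> Hom C b c"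
    and "mono_arrow C p" and "mono_arrow C i"
  shows "mono_arrow C (i \<cdot> p)"
  unfolding mono_arrow_def
proof (intro conjI allI ballI impI)
  have ip: "i \<cdot> p \<in> Hom C a c" by (rule Comp_Hom[OF p i])
  then show "i \<cdot> p \<in> Arr C" by (rule Hom_Arr)
  fix d g h
  assume "g \<in> Hom C d (Dom C (i \<cdot> p))" and "h \<in> Hom C d (Dom C (i \<cdot> p))"
    and eq: "i \<cdot> p \<cdot> g = i \<cdot> p \<cdot> h"
  then have g: "g \<in> Hom C d a" and h: "h \<in> Hom C d a" by (simp_all add: Hom_Dom[OF ip])
  have "i \<cdot> (p \<cdot> g) = i \<cdot> (p \<cdot> h)"
    using eq by (simp add: Comp_assoc[OF g p i] Comp_assoc[OF h p i])
  then have "p \<cdot> g = p \<cdot> h"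
    using mono_arrowD[OF \<open>mono_arrow C i\<close>] Comp_Hom[OF g p] Comp_Hom[OF h p]
    by (simp add: Hom_Dom[OF i])
  then show "g = h"
    using mono_arrowD[OF \<open>mono_arrow C p\<close>] g h by (simp add: Hom_Dom[OF p])
qed

lemma mono_arrow_pullback:
  assumes pb: "is_pullback C f j p r" and j: "mono_arrow C j"
  shows "mono_arrow C p"
  unfolding mono_arrow_def
proof (intro conjI allI ballI impI)
  from pb obtain q where f: "f \<in> Hom C (Dom C f) (Cod C f)" and j': "j \<in> Hom C (Dom C j) (Cod C f)"
    and p: "p \<in> Hom C q (Dom C f)" and r: "r \<in> Hom C q (Dom C j)" and sq: "f \<cdot> p = j \<cdot> r"
    and univ: "\<And>d u v. \<lbrakk>u \<in> Hom C d (Dom C f); v \<in> Hom C d (Dom C j); f \<cdot> u = j \<cdot> v\<rbrakk>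
      \<Longrightarrow> \<exists>!k. k \<in> Hom C d q \<and> p \<cdot> k = u \<and> r \<cdot> k = v"
    unfolding is_pullback_def by (auto simp: Hom_def)
  show "p \<in> Arr C" using p by (rule Hom_Arr)
  fix d g h
  assume "g \<in> Hom C d (Dom C p)" and "h \<in> Hom C d (Dom C p)" and eq: "p \<cdot> g = p \<cdot> h"
  then have g: "g \<in> Hom C d q" and h: "h \<in> Hom C d q" by (simp_all add: Hom_Dom[OF p])
  have sq': "f \<cdot> (p \<cdot> k) = j \<cdot> (r \<cdot> k)" if k: "k \<in> Hom C d q" for k
    using sq Comp_assoc[OF k p f] Comp_assoc[OF k r j'] by simp
  \<comment> \<open>\<open>j\<close> is monic, so the second legs of the two cones agree as well.\<close>
  have "j \<cdot> (r \<cdot> g) = j \<cdot> (r \<cdot> h)" using sq'[OF g] sq'[OF h] eq by simp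
  then have "r \<cdot> g = r \<cdot> h"
    using mono_arrowD[OF j] Comp_Hom[OF g r] Comp_Hom[OF h r] by blast
  then show "g = h"
    using univ[OF Comp_Hom[OF g p] Comp_Hom[OF g r] sq'[OF g]] g h eq by auto
qed

end

section \<open>Cartesian lifts\<close>

lemma cartesian_lift_ex1:
  assumes "cartesian_lift \<E> \<B> F i j" and "d \<in> Obj \<E>" and "g \<in> Hom \<E> d (Cod \<E> i)"
    and "h \<in> Hom \<B> (on_Obj F d) (Dom \<B> j)" and "j \<cdot>\<^bsub>\<B>\<^esub> h = on_Arr F g"
  shows "\<exists>!k. k \<in> Hom \<E> d (Dom \<E> i) \<and> on_Arr F k = h \<and> i \<cdot>\<^bsub>\<E>\<^esub> k = g"
proof -
  from assms(1) have "\<forall>d\<in>Obj \<E>. \<forall>g\<in>Hom \<E> d (Cod \<E> i). \<forall>h\<in>Hom \<B> (on_Obj F d) (Dom \<B> j).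
      j \<cdot>\<^bsub>\<B>\<^esub> h = on_Arr F g \<longrightarrow>
      (\<exists>!k. k \<in> Hom \<E> d (Dom \<E> i) \<and> on_Arr F k = h \<and> i \<cdot>\<^bsub>\<E>\<^esub> k = g)"
    unfolding cartesian_lift_def by (elim conjE)
  from this[rule_format, OF assms(2-5)] show ?thesis .
qed

context category_functor
begin

lemma on_Arr_Hom_Dom: "i \<in> Hom \<E> a b \<Longrightarrow> Dom \<B> (on_Arr F i) = on_Obj F a"
  by (rule Hom_Dom[OF on_Arr])

lemma cartesian_lift_Id:
  assumes a: "a \<in> Obj \<E>"
  shows "cartesian_lift \<E> \<B> F (Id \<E> a) (Id \<B> (on_Obj F a))"
proof -
  have Id: "Id \<E> a \<in> Hom \<E> a a" "Id \<B> (on_Obj F a) \<in> Hom \<B> (on_Obj F a) (on_Obj F a)"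
    by (rule dom.Id_Hom[OF a], rule cod.Id_Hom[OF on_Obj[OF a]])
  show ?thesis
    unfolding cartesian_lift_def
  proof (intro conjI ballI impI)
    show "Id \<E> a \<in> Arr \<E>" using Id(1) by (rule Hom_Arr)
    show "on_Arr F (Id \<E> a) = Id \<B> (on_Obj F a)" using a by (rule on_Id)
  next
    fix d g h
    assume "g \<in> Hom \<E> d (Cod \<E> (Id \<E> a))"
      and "h \<in> Hom \<B> (on_Obj F d) (Dom \<B> (Id \<B> (on_Obj F a)))"
      and "Id \<B> (on_Obj F a) \<cdot>\<^bsub>\<B>\<^esub> h = on_Arr F g"
    then have g: "g \<in> Hom \<E> d a" and h: "h = on_Arr F g"
      unfolding Hom_Cod[OF Id(1)] Hom_Dom[OF Id(2)] by (simp_all add: cod.Comp_Id_left)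
    show "\<exists>!k. k \<in> Hom \<E> d (Dom \<E> (Id \<E> a)) \<and> on_Arr F k = h \<and> Id \<E> a \<cdot>\<^bsub>\<E>\<^esub> k = g"
      unfolding Hom_Dom[OF Id(1)]
    proof (rule ex1I[of _ g])
      show "g \<in> Hom \<E> d a \<and> on_Arr F g = h \<and> Id \<E> a \<cdot>\<^bsub>\<E>\<^esub> g = g"
        using g h dom.Comp_Id_left[OF g] by blast
    next
      fix k
      assume k: "k \<in> Hom \<E> d a \<and> on_Arr F k = h \<and> Id \<E> a \<cdot>\<^bsub>\<E>\<^esub> k = g"
      then have "Id \<E> a \<cdot>\<^bsub>\<E>\<^esub> k = k" by (elim conjE) (rule dom.Comp_Id_left)
      with k show "k = g" by simp
    qed
  qed
qed

lemma cartesian_lift_Comp: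
  assumes p: "p \<in> Hom \<E> a b" and i: "i \<in> Hom \<E> b c"
    and cp: "cartesian_lift \<E> \<B> F p p\<^sub>0" and ci: "cartesian_lift \<E> \<B> F i i\<^sub>0"
  shows "cartesian_lift \<E> \<B> F (i \<cdot>\<^bsub>\<E>\<^esub> p) (i\<^sub>0 \<cdot>\<^bsub>\<B>\<^esub> p\<^sub>0)"
proof -
  have ip: "i \<cdot>\<^bsub>\<E>\<^esub> p \<in> Hom \<E> a c" using p i by (rule dom.Comp_Hom)
  have Fp: "on_Arr F p = p\<^sub>0" and Fi: "on_Arr F i = i\<^sub>0"
    using cp ci by (auto simp: cartesian_lift_def)
  have p\<^sub>0: "p\<^sub>0 \<in> Hom \<B> (on_Obj F a) (on_Obj F b)" and i\<^sub>0: "i\<^sub>0 \<in> Hom \<B> (on_Obj F b) (on_Obj F c)"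
    using on_Arr[OF p] on_Arr[OF i] Fp Fi by auto
  show ?thesis
    unfolding cartesian_lift_def
  proof (intro conjI ballI impI)
    show "i \<cdot>\<^bsub>\<E>\<^esub> p \<in> Arr \<E>" using ip by (rule Hom_Arr)
    show "on_Arr F (i \<cdot>\<^bsub>\<E>\<^esub> p) = i\<^sub>0 \<cdot>\<^bsub>\<B>\<^esub> p\<^sub>0" using on_Comp[OF p i] Fp Fi by simp
  next
    fix d g h
    assume d: "d \<in> Obj \<E>" and "g \<in> Hom \<E> d (Cod \<E> (i \<cdot>\<^bsub>\<E>\<^esub> p))"
      and "h \<in> Hom \<B> (on_Obj F d) (Dom \<B> (i\<^sub>0 \<cdot>\<^bsub>\<B>\<^esub> p\<^sub>0))"
      and eq: "i\<^sub>0 \<cdot>\<^bsub>\<B>\<^esub> p\<^sub>0 \<cdot>\<^bsub>\<B>\<^esub> h = on_Arr F g"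
    then have g: "g \<in> Hom \<E> d c" and h: "h \<in> Hom \<B> (on_Obj F d) (on_Obj F a)"
      by (auto simp: Hom_Cod[OF ip] Hom_Dom[OF cod.Comp_Hom[OF p\<^sub>0 i\<^sub>0]])
    have p\<^sub>0h: "p\<^sub>0 \<cdot>\<^bsub>\<B>\<^esub> h \<in> Hom \<B> (on_Obj F d) (on_Obj F b)" using h p\<^sub>0 by (rule cod.Comp_Hom)
    \<comment> \<open>Factor through \<open>i\<close> above \<open>p\<^sub>0 \<cdot> h\<close>, then through \<open>p\<close> above \<open>h\<close>.\<close>
    have ex_m: "\<exists>!m. m \<in> Hom \<E> d b \<and> on_Arr F m = p\<^sub>0 \<cdot>\<^bsub>\<B>\<^esub> h \<and> i \<cdot>\<^bsub>\<E>\<^esub> m = g"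
      using cartesian_lift_ex1[OF ci d, of g "p\<^sub>0 \<cdot>\<^bsub>\<B>\<^esub> h"] g p\<^sub>0h eq cod.Comp_assoc[OF h p\<^sub>0 i\<^sub>0]
      by (simp add: Hom_Dom[OF i] Hom_Cod[OF i] Hom_Dom[OF i\<^sub>0])
    then obtain m where m: "m \<in> Hom \<E> d b" "on_Arr F m = p\<^sub>0 \<cdot>\<^bsub>\<B>\<^esub> h" "i \<cdot>\<^bsub>\<E>\<^esub> m = g"
      by blast
    have ex_k: "\<exists>!k. k \<in> Hom \<E> d a \<and> on_Arr F k = h \<and> p \<cdot>\<^bsub>\<E>\<^esub> k = m"
      using cartesian_lift_ex1[OF cp d, of m h] m h
      by (simp add: Hom_Dom[OF p] Hom_Cod[OF p] Hom_Dom[OF p\<^sub>0])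
    have "k \<in> Hom \<E> d a \<and> on_Arr F k = h \<and> i \<cdot>\<^bsub>\<E>\<^esub> p \<cdot>\<^bsub>\<E>\<^esub> k = g
      \<longleftrightarrow> k \<in> Hom \<E> d a \<and> on_Arr F k = h \<and> p \<cdot>\<^bsub>\<E>\<^esub> k = m" for k
    proof (cases "k \<in> Hom \<E> d a \<and> on_Arr F k = h")
      case True
      then have k: "k \<in> Hom \<E> d a" and Fk: "on_Arr F k = h" by auto
      have "p \<cdot>\<^bsub>\<E>\<^esub> k \<in> Hom \<E> d b" "on_Arr F (p \<cdot>\<^bsub>\<E>\<^esub> k) = p\<^sub>0 \<cdot>\<^bsub>\<B>\<^esub> h"
        using dom.Comp_Hom[OF k p] on_Comp[OF k p] Fk Fp by auto
      with ex_m m have "i \<cdot>\<^bsub>\<E>\<^esub> (p \<cdot>\<^bsub>\<E>\<^esub> k) = g \<longleftrightarrow> p \<cdot>\<^bsub>\<E>\<^esub> k = m" by blast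
      then show ?thesis using dom.Comp_assoc[OF k p i] by simp
    qed blast
    with ex_k show "\<exists>!k. k \<in> Hom \<E> d (Dom \<E> (i \<cdot>\<^bsub>\<E>\<^esub> p)) \<and> on_Arr F k = h \<and> i \<cdot>\<^bsub>\<E>\<^esub> p \<cdot>\<^bsub>\<E>\<^esub> k = g"
      by (simp add: Hom_Dom[OF ip])
  qed
qed

text \<open>
  The comparison arrow of a cone on \<open>f\<close> and \<open>j\<close> must lie over the comparison arrow of the image
  cone, so its existence and uniqueness come from the cartesian arrow \<open>p\<close>. That it also
  commutes with the second leg follows from uniqueness of factorizations through the cartesian
  arrow \<open>j\<close>.
\<close>

lemma pullback_cartesian_lift:
  assumes pb: "is_pullback \<B> (on_Arr F f) (on_Arr F j) p\<^sub>0 r\<^sub>0"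
    and f: "f \<in> Hom \<E> s b" and j: "j \<in> Hom \<E> t b" and p: "p \<in> Hom \<E> q s"
    and cj: "cartesian_lift \<E> \<B> F j (on_Arr F j)" and cp: "cartesian_lift \<E> \<B> F p p\<^sub>0"
  shows "\<exists>r. is_pullback \<E> f j p r"
proof -
  have Fp: "on_Arr F p = p\<^sub>0" using cp by (simp add: cartesian_lift_def)
  have p\<^sub>0: "p\<^sub>0 \<in> Hom \<B> (on_Obj F q) (on_Obj F s)" using on_Arr[OF p] Fp by simp
  note pb\<^sub>0 = iffD1[OF is_pullback_iff[OF on_Arr[OF f] on_Arr[OF j] p\<^sub>0] pb]
  then have r\<^sub>0: "r\<^sub>0 \<in> Hom \<B> (on_Obj F q) (on_Obj F t)"
    and sq\<^sub>0: "on_Arr F f \<cdot>\<^bsub>\<B>\<^esub> p\<^sub>0 = on_Arr F j \<cdot>\<^bsub>\<B>\<^esub> r\<^sub>0"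
    and univ\<^sub>0: "\<And>d u v. \<lbrakk>u \<in> Hom \<B> d (on_Obj F s); v \<in> Hom \<B> d (on_Obj F t);
        on_Arr F f \<cdot>\<^bsub>\<B>\<^esub> u = on_Arr F j \<cdot>\<^bsub>\<B>\<^esub> v\<rbrakk>
      \<Longrightarrow> \<exists>!k. k \<in> Hom \<B> d (on_Obj F q) \<and> p\<^sub>0 \<cdot>\<^bsub>\<B>\<^esub> k = u \<and> r\<^sub>0 \<cdot>\<^bsub>\<B>\<^esub> k = v"
    by simp_all
  have lift_j: "\<exists>!k. k \<in> Hom \<E> d t \<and> on_Arr F k = h \<and> j \<cdot>\<^bsub>\<E>\<^esub> k = g"
    if "g \<in> Hom \<E> d b" "h \<in> Hom \<B> (on_Obj F d) (on_Obj F t)" "on_Arr F j \<cdot>\<^bsub>\<B>\<^esub> h = on_Arr F g"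
    for d g h
    using cartesian_lift_ex1[OF cj, of d g h] that dom.Hom_Obj
    by (simp add: Hom_Dom[OF j] Hom_Cod[OF j] on_Arr_Hom_Dom[OF j])
  have lift_p: "\<exists>!k. k \<in> Hom \<E> d q \<and> on_Arr F k = h \<and> p \<cdot>\<^bsub>\<E>\<^esub> k = g"
    if "g \<in> Hom \<E> d s" "h \<in> Hom \<B> (on_Obj F d) (on_Obj F q)" "p\<^sub>0 \<cdot>\<^bsub>\<B>\<^esub> h = on_Arr F g"
    for d g h
    using cartesian_lift_ex1[OF cp, of d g h] that dom.Hom_Obj
    by (simp add: Hom_Dom[OF p] Hom_Cod[OF p] Hom_Dom[OF p\<^sub>0])
  have "on_Arr F j \<cdot>\<^bsub>\<B>\<^esub> r\<^sub>0 = on_Arr F (f \<cdot>\<^bsub>\<E>\<^esub> p)" using on_Comp[OF p f] Fp sq\<^sub>0 by simp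
  from lift_j[OF dom.Comp_Hom[OF p f] r\<^sub>0 this]
  obtain r where r: "r \<in> Hom \<E> q t" and Fr: "on_Arr F r = r\<^sub>0" and sq: "j \<cdot>\<^bsub>\<E>\<^esub> r = f \<cdot>\<^bsub>\<E>\<^esub> p"
    by blast
  have univ: "\<exists>!k. k \<in> Hom \<E> d q \<and> p \<cdot>\<^bsub>\<E>\<^esub> k = u \<and> r \<cdot>\<^bsub>\<E>\<^esub> k = v"
    if u: "u \<in> Hom \<E> d s" and v: "v \<in> Hom \<E> d t" and uv: "f \<cdot>\<^bsub>\<E>\<^esub> u = j \<cdot>\<^bsub>\<E>\<^esub> v" for d u v
  proof -
    have Fuv: "on_Arr F f \<cdot>\<^bsub>\<B>\<^esub> on_Arr F u = on_Arr F j \<cdot>\<^bsub>\<B>\<^esub> on_Arr F v"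
      using on_Comp[OF u f] on_Comp[OF v j] uv by simp
    note ex_k\<^sub>0 = univ\<^sub>0[OF on_Arr[OF u] on_Arr[OF v] Fuv]
    then obtain k\<^sub>0 where k\<^sub>0: "k\<^sub>0 \<in> Hom \<B> (on_Obj F d) (on_Obj F q)"
      "p\<^sub>0 \<cdot>\<^bsub>\<B>\<^esub> k\<^sub>0 = on_Arr F u" "r\<^sub>0 \<cdot>\<^bsub>\<B>\<^esub> k\<^sub>0 = on_Arr F v" by blast
    note ex_k = lift_p[OF u k\<^sub>0(1,2)]
    then obtain k where k: "k \<in> Hom \<E> d q" "on_Arr F k = k\<^sub>0" "p \<cdot>\<^bsub>\<E>\<^esub> k = u" by blast
    have "j \<cdot>\<^bsub>\<E>\<^esub> (r \<cdot>\<^bsub>\<E>\<^esub> k) = j \<cdot>\<^bsub>\<E>\<^esub> v"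
      using dom.Comp_assoc[OF k(1) r j] dom.Comp_assoc[OF k(1) p f] sq k(3) uv by simp
    moreover have "on_Arr F (r \<cdot>\<^bsub>\<E>\<^esub> k) = on_Arr F v"
      using on_Comp[OF k(1) r] Fr k(2) k\<^sub>0(3) by simp
    ultimately have rk: "r \<cdot>\<^bsub>\<E>\<^esub> k = v"
      using lift_j[OF dom.Comp_Hom[OF v j] on_Arr[OF v] on_Comp[OF v j, symmetric]]
        dom.Comp_Hom[OF k(1) r] v by blast
    show ?thesis
    proof (rule ex1I[of _ k])
      show "k \<in> Hom \<E> d q \<and> p \<cdot>\<^bsub>\<E>\<^esub> k = u \<and> r \<cdot>\<^bsub>\<E>\<^esub> k = v" using k rk by blast
    next
      fix k'
      assume k': "k' \<in> Hom \<E> d q \<and> p \<cdot>\<^bsub>\<E>\<^esub> k' = u \<and> r \<cdot>\<^bsub>\<E>\<^esub> k' = v"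
      have "on_Arr F k' \<in> Hom \<B> (on_Obj F d) (on_Obj F q)" using k' on_Arr by blast
      moreover have "p\<^sub>0 \<cdot>\<^bsub>\<B>\<^esub> on_Arr F k' = on_Arr F u" "r\<^sub>0 \<cdot>\<^bsub>\<B>\<^esub> on_Arr F k' = on_Arr F v"
        using k' on_Comp[OF _ p, of k' d] on_Comp[OF _ r, of k' d] Fp Fr by auto
      ultimately have "on_Arr F k' = k\<^sub>0" using ex_k\<^sub>0 k\<^sub>0 by blast
      then show "k' = k" using ex_k k k' by blast
    qed
  qed
  have "is_pullback \<E> f j p r"
    unfolding is_pullback_iff[OF f j p] using r sq univ by simp
  then show ?thesis by blast
qed

end

section \<open>The inverse image of a base of computability\<close>

theorem proposition4p3:
  fixes \<E> :: "('o1, 'm1, 'z1) category_scheme"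
    and \<B> :: "('o2, 'm2, 'z2) category_scheme"
    and F :: "('o1, 'm1, 'o2, 'm2) functor_maps"
    and B :: "'o2 \<Rightarrow> 'm2 set"
  assumes "grothendieck_fibration \<E> \<B> F"
    and "base_of_computability \<B> B"
  shows "base_of_computability \<E> (inverse_image_base \<E> \<B> F B)"
proof -
  interpret grothendieck_fibration \<E> \<B> F by fact
  have B_Id: "Id \<B> x \<in> B x" if "x \<in> Obj \<B>" for x
    using assms(2) that unfolding base_of_computability_def by blast
  have B_pullback: "\<exists>p r. is_pullback \<B> f j p r \<and> i \<cdot>\<^bsub>\<B>\<^esub> p \<in> B x"
    if "x \<in> Obj \<B>" "y \<in> Obj \<B>" "i \<in> B x" "j \<in> B y" "f \<in> Hom \<B> (Dom \<B> i) y" for x y i j f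
    using assms(2) that unfolding base_of_computability_def by blast
  show ?thesis
    unfolding base_of_computability_def
  proof (intro conjI ballI)
    fix a
    show "inverse_image_base \<E> \<B> F B a \<subseteq> Mon \<E> a" by (auto simp: inverse_image_base_def)
  next
    fix a
    assume a: "a \<in> Obj \<E>"
    show "Id \<E> a \<in> inverse_image_base \<E> \<B> F B a"
      using dom.mono_arrow_Id[OF a] cartesian_lift_Id[OF a] B_Id[OF on_Obj[OF a]]
        Hom_Cod[OF dom.Id_Hom[OF a]]
      by (auto simp: inverse_image_base_def Mon_def)
  next
    fix a b i j f
    assume a: "a \<in> Obj \<E>" and b: "b \<in> Obj \<E>"
      and i_base: "i \<in> inverse_image_base \<E> \<B> F B a"
      and j_base: "j \<in> inverse_image_base \<E> \<B> F B b"
      and f: "f \<in> Hom \<E> (Dom \<E> i) b"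
    from i_base have i_mono: "mono_arrow \<E> i" and i: "i \<in> Hom \<E> (Dom \<E> i) a"
      and ci: "cartesian_lift \<E> \<B> F i (on_Arr F i)" and iB: "on_Arr F i \<in> B (on_Obj F a)"
      by (auto simp: inverse_image_base_def Mon_def mono_arrow_def cartesian_lift_def Hom_def)
    from j_base have j_mono: "mono_arrow \<E> j" and j: "j \<in> Hom \<E> (Dom \<E> j) b"
      and cj: "cartesian_lift \<E> \<B> F j (on_Arr F j)" and jB: "on_Arr F j \<in> B (on_Obj F b)"
      by (auto simp: inverse_image_base_def Mon_def mono_arrow_def cartesian_lift_def Hom_def)
    obtain p\<^sub>0 r\<^sub>0 where pb\<^sub>0: "is_pullback \<B> (on_Arr F f) (on_Arr F j) p\<^sub>0 r\<^sub>0"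
      and ip\<^sub>0: "on_Arr F i \<cdot>\<^bsub>\<B>\<^esub> p\<^sub>0 \<in> B (on_Obj F a)"
      using B_pullback[OF on_Obj[OF a] on_Obj[OF b] iB jB, unfolded on_Arr_Hom_Dom[OF i],
          OF on_Arr[OF f]]
      by blast
    obtain x where "p\<^sub>0 \<in> Hom \<B> x (on_Obj F (Dom \<E> i))"
      using pb\<^sub>0 unfolding is_pullback_def on_Arr_Hom_Dom[OF f] by blast
    then obtain p where "Cod \<E> p = Dom \<E> i" and cp: "cartesian_lift \<E> \<B> F p p\<^sub>0"
      using ex_cartesian_lift dom.Hom_Obj[OF i] by blast
    then have p: "p \<in> Hom \<E> (Dom \<E> p) (Dom \<E> i)" by (simp add: cartesian_lift_def Hom_def)
    obtain r where pb: "is_pullback \<E> f j p r"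
      using pullback_cartesian_lift[OF pb\<^sub>0 f j p cj cp] by blast
    have "mono_arrow \<E> (i \<cdot>\<^bsub>\<E>\<^esub> p)"
      using p i dom.mono_arrow_pullback[OF pb j_mono] i_mono by (rule dom.mono_arrow_Comp)
    then have "i \<cdot>\<^bsub>\<E>\<^esub> p \<in> inverse_image_base \<E> \<B> F B a"
      using cartesian_lift_Comp[OF p i cp ci] ip\<^sub>0 Hom_Cod[OF dom.Comp_Hom[OF p i]]
      by (auto simp: inverse_image_base_def Mon_def)
    with pb show "\<exists>p r. is_pullback \<E> f j p r \<and> i \<cdot>\<^bsub>\<E>\<^esub> p \<in> inverse_image_base \<E> \<B> F B a"
      by blast
  qed
qed

end
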